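(* Let $X,Y$ be Banach spaces, $D\subset X$ a convex open subset, and $T:D\subset X\to Y$ a Fréchet differentiable operator. Let $q\in(0,1]$ and let $\kappa_0>0$, $\kappa>0$ be parameters with $\kappa_0\le\kappa$, and let $\rho>0$ be the radius determined by $\kappa_0,\kappa,q$ as defined in the context. Assume that there exists $x^*\in D$ such that $T(x^* )=0$, $[T'(x^* )]^{-1}\in L(Y,X)$, and for all $x,y\in D$ $$\|[T'(x^* )]^{-1}(T'(x)-T'(x^* ))\|\le \kappa_0\|x-x^*\|^q,$$ $$\|[T'(x^* )]^{-1}(T'(x)-T'(y))\|\le \kappa\|x-y\|^q,$$ and that $B(x^*,\rho)\subseteq D$. Let $x_0\in B(x^*,\rho)\setminus\{x^*\}$. Then the sequence $\{x_n\}$ generated from $x_0$ by $$y_n=x_n-\tfrac12[T'(x_n)]^{-1}T(x_n),\qquad z_n^{(1)}=x_n-[T'(y_n)]^{-1}T(x_n),$$ $$z_n^{(2)}=z_n^{(1)}-\big(2[T'(y_n)]^{-1}-[T'(x_n)]^{-1}\big)T(z_n^{(1)}),$$ $$x_{n+1}=z_n^{(2)}-\big(2[T'(y_n)]^{-1}-[T'(x_n)]^{-1}\big)T(z_n^{(2)})$$ is well defined in $B(x^*,\rho)$, remains in $B(x^*,\rho)$ for each $n=0,1,2,\dots$, and converges to $x^*$. Moreover, for all $n=0,1,2,\dots$: $$\|y_n-x^*\|\le \mu_1(\|x_n-x^*\|)\|x_n-x^*\|\le\|x_n-x^*\|<\rho,$$ $$\|z_n^{(1)}-x^*\|\le \mu_2(\|x_n-x^*\|)\|x_n-x^*\|\le\|x_n-x^*\|<\rho,$$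 $$\|z_n^{(2)}-x^*\|\le \mu_3(\|x_n-x^*\|)\|x_n-x^*\|\le\|x_n-x^*\|<\rho,$$ $$\|x_{n+1}-x^*\|\le \mu_4(\|x_n-x^*\|)\|x_n-x^*\|\le\|x_n-x^*\|<\rho,$$ where $\mu_1,\dots,\mu_4$ are the functions defined in the context. Furthermore, if there exists $\varrho\in\left[\rho,\left(\frac{1+q}{\kappa_0}\right)^{1/q}\right]$ such that $\overline{B(x^*,\varrho)}\subseteq D$, then the limit point $x^*$ is the only solution of the equation $T(x)=0$ in $D_1=D\cap\overline{B(x^*,\varrho)}$.
   Context: $L(Y,X)$ denotes the set of bounded linear operators from $Y$ to $X$; $T'(x)$ is the first Fréchet derivative of $T$ at $x$; $B(x^*,r)$ and $\overline{B(x^*,r)}$ are the open and closed balls in $X$ with center $x^*$ and radius $r$. For $q\in(0,1]$ and $\kappa_0,\kappa>0$ with $\kappa_0\le\kappa$, define the following functions of $a$ on the interval $\left[0,\left(\frac1{\kappa_0}\right)^{1/q}\right)$, where $\mu_i(a)^q$ means $(\mu_i(a))^q$: $$\mu_1(a)=\frac{1}{1-\kappa_0a^q}\left[\frac{\kappa a^q}{q+1}+\frac{1+\frac{\kappa_0}{q+1}a^q}{2}\right],\qquad p(a)=\kappa_0\mu_1(a)^qa^q,$$ $$\mu_2(a)=\frac{1}{1-\kappa_0a^q}\left[\frac{\kappa a^q}{q+1}+\frac{\kappa[1+\mu_1(a)^q]\left[\frac{\kappa_0}{q+1}a^q+1\right]a^q}{1-p(a)}\right],$$ and, for $j=3,4$,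 $$\mu_j(a)=\Bigg[\frac{\kappa\mu_{j-1}(a)^qa^q}{(q+1)(1-\kappa_0\mu_{j-1}(a)^qa^q)}+\frac{\kappa[\mu_1(a)^q+\mu_{j-1}(a)^q]a^q}{1-\kappa_0\mu_{j-1}(a)^qa^q}\cdot\frac{1}{1-p(a)}\left(1+\frac{\kappa_0}{q+1}\mu_{j-1}(a)^qa^q\right)$$ $$\qquad+\frac{1}{1-\kappa_0a^q}\cdot\frac{\kappa[1+\mu_1(a)^q]a^q}{1-p(a)}\left(1+\frac{\kappa_0}{q+1}\mu_{j-1}(a)^qa^q\right)\Bigg]\mu_{j-1}(a).$$ Put $M_i(a)=\mu_i(a)-1$ for $i=1,2,3,4$, and let $\rho_i$ be the smallest zero of $M_i$ in $\left(0,\left(\frac1{\kappa_0}\right)^{1/q}\right)$ (these zeros exist; in particular $\rho_1=\left(\frac{q+1}{2\kappa+\kappa_0(3+2q)}\right)^{1/q}$). The radius of convergence is $\rho=\min\{\rho_1,\rho_2,\rho_3,\rho_4\}$, and $0\le\mu_i(a)<1$ for each $a\in[0,\rho)$ and $i=1,2,3,4$.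
   Formalization: Uniqueness is stated for ϱ in [ρ, ((1+q)/κ₀)^{1/q}) without the upper end point, where the claim fails: on the real line with κ=κ₀, x*=0, T(x)=x−κ₀|x|^q x/(q+1) also vanishes at |x|=((1+q)/κ₀)^{1/q}. *)

theory Defs
  imports "HOL-Analysis.Analysis"
begin

section \<open>Inverses of bounded linear operators\<close>

text \<open>\<open>blinfun_invertible A\<close> says that the inverse of \<open>A\<close> exists and belongs to \<open>L(Y,X)\<close>;
  the term \<open>blinfun_inv A\<close> is meaningful only in that case.\<close>

definition is_blinfun_inverse ::
    "('a::real_normed_vector \<Rightarrow>\<^sub>L 'b::real_normed_vector) \<Rightarrow> ('b \<Rightarrow>\<^sub>L 'a) \<Rightarrow> bool" where
  "is_blinfun_inverse A B \<longleftrightarrow> A o\<^sub>L B = id_blinfun \<and> B o\<^sub>L A = id_blinfun"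

definition blinfun_invertible ::
    "('a::real_normed_vector \<Rightarrow>\<^sub>L 'b::real_normed_vector) \<Rightarrow> bool" where
  "blinfun_invertible A \<longleftrightarrow> (\<exists>B. is_blinfun_inverse A B)"

definition blinfun_inv ::
    "('a::real_normed_vector \<Rightarrow>\<^sub>L 'b::real_normed_vector) \<Rightarrow> ('b \<Rightarrow>\<^sub>L 'a)" where
  "blinfun_inv A = (THE B. is_blinfun_inverse A B)"

section \<open>The functions \<open>\<mu>\<^sub>1, \<dots>, \<mu>\<^sub>4\<close> and the radius of convergence\<close>

definition mu1 :: "real \<Rightarrow> real \<Rightarrow> real \<Rightarrow> real \<Rightarrow> real" where
  "mu1 q \<kappa>\<^sub>0 \<kappa> a = 1 / (1 - \<kappa>\<^sub>0 * a powr q) *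
     (\<kappa> * a powr q / (q + 1) + (1 + \<kappa>\<^sub>0 / (q + 1) * a powr q) / 2)"

definition p_fun :: "real \<Rightarrow> real \<Rightarrow> real \<Rightarrow> real \<Rightarrow> real" where
  "p_fun q \<kappa>\<^sub>0 \<kappa> a = \<kappa>\<^sub>0 * mu1 q \<kappa>\<^sub>0 \<kappa> a powr q * a powr q"

definition mu2 :: "real \<Rightarrow> real \<Rightarrow> real \<Rightarrow> real \<Rightarrow> real" where
  "mu2 q \<kappa>\<^sub>0 \<kappa> a = 1 / (1 - \<kappa>\<^sub>0 * a powr q) *
     (\<kappa> * a powr q / (q + 1)
      + \<kappa> * (1 + mu1 q \<kappa>\<^sub>0 \<kappa> a powr q) * (\<kappa>\<^sub>0 / (q + 1) * a powr q + 1) * a powr q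
          / (1 - p_fun q \<kappa>\<^sub>0 \<kappa> a))"

text \<open>The recursion giving \<open>\<mu>\<^sub>j(a)\<close> from \<open>m = \<mu>\<^sub>j\<^sub>-\<^sub>1(a)\<close> for \<open>j = 3, 4\<close>.\<close>

definition mu_next :: "real \<Rightarrow> real \<Rightarrow> real \<Rightarrow> real \<Rightarrow> real \<Rightarrow> real" where
  "mu_next q \<kappa>\<^sub>0 \<kappa> m a =
     (\<kappa> * m powr q * a powr q / ((q + 1) * (1 - \<kappa>\<^sub>0 * m powr q * a powr q))
      + \<kappa> * (mu1 q \<kappa>\<^sub>0 \<kappa> a powr q + m powr q) * a powr q / (1 - \<kappa>\<^sub>0 * m powr q * a powr q)
          * (1 / (1 - p_fun q \<kappa>\<^sub>0 \<kappa> a)) * (1 + \<kappa>\<^sub>0 / (q + 1) * m powr q * a powr q)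
      + 1 / (1 - \<kappa>\<^sub>0 * a powr q)
          * (\<kappa> * (1 + mu1 q \<kappa>\<^sub>0 \<kappa> a powr q) * a powr q / (1 - p_fun q \<kappa>\<^sub>0 \<kappa> a))
          * (1 + \<kappa>\<^sub>0 / (q + 1) * m powr q * a powr q)) * m"

definition mu3 :: "real \<Rightarrow> real \<Rightarrow> real \<Rightarrow> real \<Rightarrow> real" where
  "mu3 q \<kappa>\<^sub>0 \<kappa> a = mu_next q \<kappa>\<^sub>0 \<kappa> (mu2 q \<kappa>\<^sub>0 \<kappa> a) a"

definition mu4 :: "real \<Rightarrow> real \<Rightarrow> real \<Rightarrow> real \<Rightarrow> real" where
  "mu4 q \<kappa>\<^sub>0 \<kappa> a = mu_next q \<kappa>\<^sub>0 \<kappa> (mu3 q \<kappa>\<^sub>0 \<kappa> a) a"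

text \<open>The smallest zero of \<open>\<mu>(a) - 1\<close> in \<open>(0, (1/\<kappa>\<^sub>0)\<^sup>1\<^sup>/\<^sup>q)\<close>. For \<open>\<mu>\<^sub>2, \<mu>\<^sub>3, \<mu>\<^sub>4\<close> further denominators
  vanish inside this interval. Each function blows up to \<open>+\<infinity>\<close> on approaching its first singularity,
  so its smallest zero lies to the left of it and is unaffected by the totalised values of
  division and \<open>powr\<close> at or beyond the singularity.\<close>

definition smallest_zero :: "real \<Rightarrow> real \<Rightarrow> (real \<Rightarrow> real) \<Rightarrow> real" where
  "smallest_zero q \<kappa>\<^sub>0 \<mu> = (LEAST r. r \<in> {0<..<(1 / \<kappa>\<^sub>0) powr (1 / q)} \<and> \<mu> r - 1 = 0)"

definition rho :: "real \<Rightarrow> real \<Rightarrow> real \<Rightarrow> real" where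
  "rho q \<kappa>\<^sub>0 \<kappa> = Min {smallest_zero q \<kappa>\<^sub>0 (mu1 q \<kappa>\<^sub>0 \<kappa>), smallest_zero q \<kappa>\<^sub>0 (mu2 q \<kappa>\<^sub>0 \<kappa>),
                    smallest_zero q \<kappa>\<^sub>0 (mu3 q \<kappa>\<^sub>0 \<kappa>), smallest_zero q \<kappa>\<^sub>0 (mu4 q \<kappa>\<^sub>0 \<kappa>)}"

section \<open>The iterative method\<close>

text \<open>Here \<open>T'\<close> is the derivative of \<open>T\<close>, as an operator-valued map, and \<open>x\<close> is the current iterate.
  Well-definedness of the method (invertibility of \<open>T' x\<^sub>n\<close> and \<open>T' y\<^sub>n\<close>, and all arguments
  of \<open>T\<close> lying in its domain) must be claimed separately, since these functions are total.\<close>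

definition y_step ::
    "('a::real_normed_vector \<Rightarrow> 'b::real_normed_vector) \<Rightarrow> ('a \<Rightarrow> 'a \<Rightarrow>\<^sub>L 'b) \<Rightarrow> 'a \<Rightarrow> 'a" where
  "y_step T T' x = x - (1 / 2) *\<^sub>R blinfun_inv (T' x) (T x)"

definition z1_step ::
    "('a::real_normed_vector \<Rightarrow> 'b::real_normed_vector) \<Rightarrow> ('a \<Rightarrow> 'a \<Rightarrow>\<^sub>L 'b) \<Rightarrow> 'a \<Rightarrow> 'a" where
  "z1_step T T' x = x - blinfun_inv (T' (y_step T T' x)) (T x)"

definition z2_step ::
    "('a::real_normed_vector \<Rightarrow> 'b::real_normed_vector) \<Rightarrow> ('a \<Rightarrow> 'a \<Rightarrow>\<^sub>L 'b) \<Rightarrow> 'a \<Rightarrow> 'a" where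
  "z2_step T T' x = z1_step T T' x
     - (2 *\<^sub>R blinfun_inv (T' (y_step T T' x)) - blinfun_inv (T' x)) (T (z1_step T T' x))"

definition x_step ::
    "('a::real_normed_vector \<Rightarrow> 'b::real_normed_vector) \<Rightarrow> ('a \<Rightarrow> 'a \<Rightarrow>\<^sub>L 'b) \<Rightarrow> 'a \<Rightarrow> 'a" where
  "x_step T T' x = z2_step T T' x
     - (2 *\<^sub>R blinfun_inv (T' (y_step T T' x)) - blinfun_inv (T' x)) (T (z2_step T T' x))"

primrec x_seq ::
    "('a::real_normed_vector \<Rightarrow> 'b::real_normed_vector) \<Rightarrow> ('a \<Rightarrow> 'a \<Rightarrow>\<^sub>L 'b) \<Rightarrow> 'a \<Rightarrow> nat \<Rightarrow> 'a" where
  "x_seq T T' x\<^sub>0 0 = x\<^sub>0"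
| "x_seq T T' x\<^sub>0 (Suc n) = x_step T T' (x_seq T T' x\<^sub>0 n)"

text \<open>Uniqueness of the solution in the closed ball of radius \<open>r\<close> needs \<open>r < ((1+q)/\<kappa>\<^sub>0)\<^sup>1\<^sup>/\<^sup>q\<close>
  with strict inequality. On the real line, with \<open>\<kappa> = \<kappa>\<^sub>0\<close>, the map
  \<open>T x = x - \<kappa>\<^sub>0 \<bar>x\<bar>\<^sup>q x / (q+1)\<close> has derivative \<open>1 - \<kappa>\<^sub>0 \<bar>x\<bar>\<^sup>q\<close> and satisfies both Hoelder conditions at
  the solution \<open>0\<close>, but it also vanishes at distance exactly \<open>((1+q)/\<kappa>\<^sub>0)\<^sup>1\<^sup>/\<^sup>q\<close> from \<open>0\<close>.\<close>

end

theory Submission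
  imports Defs
begin

text \<open>The Hoelder condition at \<open>xs\<close> makes \<open>T' u\<close> an invertible perturbation of \<open>T' xs\<close>, and
  integrating the Hoelder conditions along segments bounds the first-order remainders of \<open>T\<close>.
  Each substep of the method is a Newton step plus differences of inverses, which gives the
  factors \<open>\<mu>\<^sub>1, \<dots>, \<mu>\<^sub>4\<close>. The smallest zeros satisfy \<open>\<rho>\<^sub>4 \<le> \<rho>\<^sub>3 \<le> \<rho>\<^sub>2 \<le> \<rho>\<^sub>1\<close>: indeed \<open>\<mu>\<^sub>2(\<rho>\<^sub>1) \<ge> 1\<close>, and the
  expression defining \<open>\<mu>\<^sub>j\<close> from \<open>\<mu>\<^sub>j\<^sub>-\<^sub>1\<close> is increasing in \<open>\<mu>\<^sub>j\<^sub>-\<^sub>1\<close> and dominates \<open>\<mu>\<^sub>2\<close> when \<open>\<mu>\<^sub>j\<^sub>-\<^sub>1 = 1\<close>.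
  Hence \<open>\<rho> = \<rho>\<^sub>4\<close>, no singularity of the \<open>\<mu>\<^sub>i\<close> is met on \<open>[0, \<rho>]\<close>, and by compactness the iteration
  contracts with a uniform factor.\<close>

text \<open>After division by \<open>a + b\<close> both summands lie in [0,1], where
  \<open>u \<le> u powr q\<close> because \<open>q \<le> 1\<close>, and they sum to 1. This later
  splits a Hoelder bound in \<open>norm (u - v)\<close> into separate powers of the distances to
  \<open>xs\<close>.\<close>

lemma powr_add_le_add_powr:
  fixes a b q :: real
  assumes "0 \<le> a" "0 \<le> b" "0 < q" "q \<le> 1"
  shows "(a + b) powr q \<le> a powr q + b powr q"
proof (cases "a + b = 0")
  case False
  define s where "s = a + b"
  have s: "0 < s"
    using False assms by (simp add: s_def)
  have le: "u \<le> u powr q" if "0 \<le> u" "u \<le> 1" for u :: real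
    using powr_mono'[of q 1 u] assms that by simp
  have "1 = a / s + b / s"
    using s by (simp add: s_def flip: add_divide_distrib)
  also have "\<dots> \<le> (a / s) powr q + (b / s) powr q"
    using assms s by (intro add_mono le) (auto simp: s_def)
  also have "\<dots> = (a powr q + b powr q) / s powr q"
    using assms s by (simp add: powr_divide add_divide_distrib)
  finally show ?thesis
    using s by (simp add: s_def field_simps)
qed (use assms in auto)

section \<open>Perturbation of invertible operators\<close>

lemma blinfun_inv_eqI:
  assumes "is_blinfun_inverse A B"
  shows "blinfun_inv A = B"
  unfolding blinfun_inv_def
proof (rule the_equality)
  fix C assume C: "is_blinfun_inverse A C"
  show "C = B"
  proof (rule blinfun_eqI)
    fix w
    have "C w = C (A (B w))"
      using assms by (metis is_blinfun_inverse_def blinfun_apply_blinfun_compose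
          blinfun_apply_id_blinfun)
    also have "\<dots> = B w"
      using C by (metis is_blinfun_inverse_def blinfun_apply_blinfun_compose
          blinfun_apply_id_blinfun)
    finally show "C w = B w" .
  qed
qed (fact assms)

lemma
  assumes "blinfun_invertible A"
  shows blinfun_inv_left [simp]: "blinfun_inv A (A v) = v"
    and blinfun_inv_right [simp]: "A (blinfun_inv A w) = w"
proof -
  have "is_blinfun_inverse A (blinfun_inv A)"
    using assms blinfun_inv_eqI unfolding blinfun_invertible_def by metis
  then show "blinfun_inv A (A v) = v" "A (blinfun_inv A w) = w"
    by (metis is_blinfun_inverse_def blinfun_apply_blinfun_compose blinfun_apply_id_blinfun)+
qed

text \<open>A Banach perturbation argument: \<open>A\<close> after \<open>S\<close> differs from the
  identity by at most \<open>c\<close>, so solving \<open>S v = w\<close> becomes a fixed-point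
  problem for a contraction, and the lower bound on \<open>A (S v)\<close> gives injectivity. The
  estimate compares with \<open>norm (blinfun_inv S0 w)\<close> rather than \<open>norm w\<close>,
  because the Hoelder conditions control only quantities premultiplied by a fixed inverse.\<close>

lemma blinfun_invertible_perturbation:
  fixes S S0 :: "'a::banach \<Rightarrow>\<^sub>L 'b::real_normed_vector"
  assumes S0: "blinfun_invertible S0"
    and close: "norm (blinfun_inv S0 o\<^sub>L (S - S0)) \<le> c" and c: "c < 1"
  shows "blinfun_invertible S"
    and "norm (blinfun_inv S w) \<le> norm (blinfun_inv S0 w) / (1 - c)"
proof -
  define A where "A = blinfun_inv S0"
  have c0: "0 \<le> c"
    using close norm_ge_zero order_trans by blast
  have near: "norm (A (S v) - v) \<le> c * norm v" for v
  proof -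
    have "A (S v) - v = (A o\<^sub>L (S - S0)) v"
      using S0 by (simp add: A_def blinfun.diff_left blinfun.diff_right)
    also have "norm \<dots> \<le> norm (A o\<^sub>L (S - S0)) * norm v"
      by (rule norm_blinfun)
    also have "\<dots> \<le> c * norm v"
      using close by (simp add: A_def mult_right_mono)
    finally show ?thesis .
  qed
  have lower: "(1 - c) * norm v \<le> norm (A (S v))" for v
    using near[of v] norm_triangle_ineq2[of v "A (S v)"]
    by (simp add: algebra_simps norm_minus_commute)
  have ex: "\<exists>v. S v = w" for w
  proof -
    have "\<exists>!v. v - A (S v) + A w = v"
    proof (rule banach_fix_type[OF c0 c], intro allI)
      fix u v
      have "(u - A (S u) + A w) - (v - A (S v) + A w) = - (A (S (u - v)) - (u - v))"
        by (simp add: blinfun.diff_right)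
      then show "dist (u - A (S u) + A w) (v - A (S v) + A w) \<le> c * dist u v"
        using near[of "u - v"] by (metis dist_norm norm_minus_cancel)
    qed
    then obtain v where "v - A (S v) + A w = v"
      by blast
    \<comment> \<open>The fixed point satisfies \<open>A (S v) = A w\<close>; applying
      \<open>S0\<close> cancels \<open>A\<close>.\<close>
    then have "S0 (A (S v)) = S0 (A w)"
      by (simp add: algebra_simps)
    then show ?thesis
      using S0 by (auto simp: A_def)
  qed
  have inj: "u = v" if "S u = S v" for u v
  proof -
    have "(1 - c) * norm (u - v) \<le> 0"
      using lower[of "u - v"] that by (simp add: blinfun.diff_right)
    then show ?thesis
      using c by (simp add: mult_le_0_iff)
  qed
  \<comment> \<open>Preimages are chosen pointwise; injectivity of \<open>S\<close> forces the
    choice to be linear, and the lower bound makes it bounded.\<close>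
  define g where "g w = (SOME v. S v = w)" for w
  have Sg: "S (g w) = w" for w
    unfolding g_def using ex by (rule someI_ex)
  have bound: "norm (g w) \<le> norm (A w) / (1 - c)" for w
    using lower[of "g w"] c by (simp add: Sg field_simps)
  have "bounded_linear g"
  proof (rule bounded_linear_intro)
    show "g (u + v) = g u + g v" for u v
      by (rule inj) (simp add: Sg blinfun.add_right)
    show "g (r *\<^sub>R u) = r *\<^sub>R g u" for r u
      by (rule inj) (simp add: Sg blinfun.scaleR_right)
    show "norm (g w) \<le> norm w * (norm A / (1 - c))" for w
    proof -
      have "norm (A w) / (1 - c) \<le> norm A * norm w / (1 - c)"
        using c by (intro divide_right_mono norm_blinfun) simp
      then show ?thesis
        using bound[of w] by (simp add: mult.commute)
    qed
  qed
  then have G: "blinfun_apply (Blinfun g) = g"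
    by (simp add: bounded_linear_Blinfun_apply)
  have is_inv: "is_blinfun_inverse S (Blinfun g)"
    unfolding is_blinfun_inverse_def
    by (auto intro!: blinfun_eqI inj simp: G Sg)
  then show "blinfun_invertible S"
    by (auto simp: blinfun_invertible_def)
  show "norm (blinfun_inv S w) \<le> norm (blinfun_inv S0 w) / (1 - c)"
    using bound[of w] by (simp add: blinfun_inv_eqI[OF is_inv] G A_def)
qed

text \<open>Rests on the identity R^-1 - S^-1 = - R^-1 (R - S) S^-1. The middle factor contributes
  \<open>e\<close>, and the perturbation bounds for the two outer inverses contribute the two
  denominators.\<close>

lemma norm_blinfun_inv_diff_le:
  fixes R S S0 :: "'a::banach \<Rightarrow>\<^sub>L 'b::real_normed_vector"
  assumes S0: "blinfun_invertible S0"
    and R: "norm (blinfun_inv S0 o\<^sub>L (R - S0)) \<le> c" "c < 1"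
    and S: "norm (blinfun_inv S0 o\<^sub>L (S - S0)) \<le> d" "d < 1"
    and RS: "norm (blinfun_inv S0 o\<^sub>L (R - S)) \<le> e"
  shows "norm (blinfun_inv R w - blinfun_inv S w)
    \<le> e / ((1 - c) * (1 - d)) * norm (blinfun_inv S0 w)"
proof -
  note invR = blinfun_invertible_perturbation[OF S0 R]
  note invS = blinfun_invertible_perturbation[OF S0 S]
  define u where "u = blinfun_inv S w"
  have "blinfun_inv R w - u = - blinfun_inv R ((R - S) u)"
    using invR(1) invS(1) by (simp add: u_def blinfun.diff_left blinfun.diff_right)
  then have "norm (blinfun_inv R w - u) = norm (blinfun_inv R ((R - S) u))"
    by simp
  also have "\<dots> \<le> norm ((blinfun_inv S0 o\<^sub>L (R - S)) u) / (1 - c)"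
    using invR(2)[of "(R - S) u"] by simp
  also have "\<dots> \<le> e * (norm (blinfun_inv S0 w) / (1 - d)) / (1 - c)"
  proof (rule divide_right_mono)
    have "norm ((blinfun_inv S0 o\<^sub>L (R - S)) u) \<le> norm (blinfun_inv S0 o\<^sub>L (R - S)) * norm u"
      by (rule norm_blinfun)
    also have "\<dots> \<le> e * (norm (blinfun_inv S0 w) / (1 - d))"
      using RS invS(2)[of w] order_trans[OF norm_ge_zero RS]
      by (intro mult_mono) (auto simp: u_def)
    finally show "norm ((blinfun_inv S0 o\<^sub>L (R - S)) u)
      \<le> e * (norm (blinfun_inv S0 w) / (1 - d))" .
  qed (use R in simp)
  finally show ?thesis
    by (simp add: u_def mult.commute)
qed

section \<open>First-order remainder under a Hoelder condition\<close>

text \<open>Mean value inequality along the segment from \<open>w\<close> to \<open>u\<close>, which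
  convexity keeps in \<open>D\<close>. With the linear part subtracted, the derivative is
  \<open>A ((T' (g t) - T' w) h)\<close>, dominated by \<open>K * e powr q * e * t powr q\<close>;
  integrating \<open>t powr q\<close> over [0,1] gives the factor \<open>1 / (q + 1)\<close>. The
  bound is asked only against the base point \<open>w\<close>, so the result serves both the
  condition centred at \<open>xs\<close> and the full Hoelder condition.\<close>

lemma holder_remainder_bound:
  fixes T :: "'a::real_normed_vector \<Rightarrow> 'b::real_normed_vector"
    and T' :: "'a \<Rightarrow> 'a \<Rightarrow>\<^sub>L 'b" and A :: "'b \<Rightarrow>\<^sub>L 'c::real_normed_vector"
  assumes "convex D" and q: "0 < q"
    and deriv: "\<And>v. v \<in> D \<Longrightarrow> (T has_derivative blinfun_apply (T' v)) (at v)"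
    and holder: "\<And>v. v \<in> D \<Longrightarrow> norm (A o\<^sub>L (T' v - T' w)) \<le> K * norm (v - w) powr q"
    and w: "w \<in> D" and u: "u \<in> D"
  shows "norm (A (T u - T w - T' w (u - w)))
    \<le> K / (q + 1) * norm (u - w) powr q * norm (u - w)"
proof -
  define h where "h = u - w"
  define e where "e = norm h"
  define g where "g t = w + t *\<^sub>R h" for t
  define f where "f t = A (T (g t) - t *\<^sub>R T' w h)" for t
  define f' where "f' t = A ((T' (g t) - T' w) h)" for t
  define \<phi> where "\<phi> t = K / (q + 1) * e powr q * e * t powr (q + 1)" for t
  define \<phi>' where "\<phi>' t = K * e powr q * e * t powr q" for t
  have g: "g t \<in> D" if "0 \<le> t" "t \<le> 1" for t
    using convexD_alt[OF \<open>convex D\<close> w u that] by (simp add: g_def h_def algebra_simps)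
  have f_deriv: "(f has_vector_derivative f' t) (at t)" if "0 \<le> t" "t \<le> 1" for t
  proof -
    have 1: "(g has_derivative (\<lambda>s. s *\<^sub>R h)) (at t)"
      unfolding g_def by (auto intro!: derivative_eq_intros)
    have "((\<lambda>s. T (g s)) has_derivative (\<lambda>s. T' (g t) (s *\<^sub>R h))) (at t)"
      using diff_chain_at[OF 1 deriv[OF g[OF that]]] by (simp add: o_def)
    then have "((\<lambda>s. T (g s) - s *\<^sub>R T' w h) has_derivative
        (\<lambda>s. T' (g t) (s *\<^sub>R h) - s *\<^sub>R T' w h)) (at t)"
      by (auto intro!: derivative_eq_intros)
    from bounded_linear.has_derivative[OF blinfun.bounded_linear_right this, of A]
    show ?thesis
      unfolding has_vector_derivative_def f_def f'_def
      by (simp add: blinfun.diff_left blinfun.diff_right blinfun.scaleR_right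
          scaleR_diff_right)
  qed
  have "norm (f 1 - f 0) \<le> \<phi> 1 - \<phi> 0"
  proof (rule differentiable_bound_general[where f' = f' and \<phi>' = \<phi>'])
    show "continuous_on {0..1} f"
      using f_deriv
      by (intro continuous_at_imp_continuous_on ballI)
        (auto intro: has_vector_derivative_continuous)
    show "continuous_on {0..1} \<phi>"
      unfolding \<phi>_def using q by (intro continuous_intros continuous_on_powr') auto
    show "(f has_vector_derivative f' t) (at t)" if "0 < t" "t < 1" for t
      using f_deriv that by simp
    \<comment> \<open>The power is differentiated only at positive \<open>t\<close>; at the end
      points continuity suffices.\<close>
    show "(\<phi> has_vector_derivative \<phi>' t) (at t)" if "0 < t" "t < 1" for t
    proof -
      have "(\<phi> has_real_derivative K / (q + 1) * e powr q * e * ((q + 1) * t powr q)) (at t)"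
        unfolding \<phi>_def using has_real_derivative_powr[of t "q + 1"] that
        by (intro DERIV_cmult) simp
      then show ?thesis
        using q by (simp add: \<phi>'_def mult.assoc has_real_derivative_iff_has_vector_derivative)
    qed
    show "norm (f' t) \<le> \<phi>' t" if t: "0 < t" "t < 1" for t
    proof -
      have "norm (f' t) \<le> norm (A o\<^sub>L (T' (g t) - T' w)) * e"
        using norm_blinfun[of "A o\<^sub>L (T' (g t) - T' w)" h] by (simp add: f'_def e_def)
      also have "\<dots> \<le> (K * norm (g t - w) powr q) * e"
        using t by (intro mult_right_mono holder g) (auto simp: e_def)
      also have "\<dots> = \<phi>' t"
        using t by (simp add: \<phi>'_def g_def e_def powr_mult mult_ac)
      finally show ?thesis .
    qed
  qed simp
  moreover have "f 1 - f 0 = A (T u - T w - T' w (u - w))"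
    by (simp add: f_def g_def h_def blinfun.diff_right)
  moreover have "\<phi> 1 - \<phi> 0 = K / (q + 1) * e powr q * e"
    using q by (simp add: \<phi>_def)
  ultimately show ?thesis
    by (simp add: e_def h_def)
qed

section \<open>The radius of convergence\<close>

text \<open>The level set \<open>\<mu> = 1\<close> on \<open>[0, s]\<close> is compact and nonempty, so the \<open>LEAST\<close> in the
  definition of the smallest zero is attained.\<close>

lemma smallest_zero_properties:
  fixes \<mu> :: "real \<Rightarrow> real"
  assumes cont: "continuous_on {0..s} \<mu>" and s: "0 \<le> s" "s < (1 / \<kappa>\<^sub>0) powr (1 / q)"
    and "\<mu> 0 < 1" and "1 \<le> \<mu> s"
  defines "r \<equiv> smallest_zero q \<kappa>\<^sub>0 \<mu>"
  shows "0 < r" and "r \<le> s" and "\<mu> r = 1" and "\<And>a. 0 \<le> a \<Longrightarrow> a < r \<Longrightarrow> \<mu> a < 1"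
proof -
  define Z where "Z = {a \<in> {0..s}. \<mu> a = 1}"
  have "closed Z"
    unfolding Z_def using continuous_closed_preimage_constant[OF cont] by simp
  moreover have "Z \<subseteq> {0..s}"
    by (auto simp: Z_def)
  ultimately have "compact Z"
    by (meson bounded_closed_interval bounded_subset compact_eq_bounded_closed)
  moreover have "Z \<noteq> {}"
    using IVT'[of \<mu> 0 1 s] assms(2,4,5) cont by (auto simp: Z_def)
  ultimately obtain b where b: "b \<in> Z" "\<And>a. a \<in> Z \<Longrightarrow> b \<le> a"
    using compact_attains_inf[of Z] by blast
  have b': "0 < b" "b \<le> s" "\<mu> b = 1"
    using b(1) \<open>\<mu> 0 < 1\<close> by (auto simp: Z_def less_le)
  have "r = b"
    unfolding r_def smallest_zero_def
  proof (rule Least_equality)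
    show "b \<in> {0<..<(1 / \<kappa>\<^sub>0) powr (1 / q)} \<and> \<mu> b - 1 = 0"
      using b' s by auto
    \<comment> \<open>Zeros beyond \<open>s\<close> exceed \<open>b\<close> anyway, since
      \<open>b \<le> s\<close>; so minimality in [0,s] is minimality in the whole interval.\<close>
    show "b \<le> a" if "a \<in> {0<..<(1 / \<kappa>\<^sub>0) powr (1 / q)} \<and> \<mu> a - 1 = 0" for a
      using that b(2)[of a] b' by (cases "a \<le> s") (auto simp: Z_def)
  qed
  with b' show "0 < r" "r \<le> s" "\<mu> r = 1"
    by auto
  show "\<mu> a < 1" if a: "0 \<le> a" "a < r" for a
  \<comment> \<open>A value of at least 1 before \<open>r\<close> would, by the intermediate value
    theorem, produce a point of level 1 before the least one.\<close>
  proof (rule ccontr)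
    assume "\<not> \<mu> a < 1"
    moreover have "continuous_on {0..a} \<mu>"
      by (rule continuous_on_subset[OF cont]) (use a b' \<open>r = b\<close> in auto)
    ultimately obtain c where "0 \<le> c" "c \<le> a" "\<mu> c = 1"
      using IVT'[of \<mu> 0 1 a] a \<open>\<mu> 0 < 1\<close> by auto
    then show False
      using b(2)[of c] a b' \<open>r = b\<close> by (auto simp: Z_def)
  qed
qed

locale holder_constants =
  fixes q \<kappa>\<^sub>0 \<kappa> :: real
  assumes q: "0 < q" "q \<le> 1" and \<kappa>: "0 < \<kappa>\<^sub>0" "\<kappa>\<^sub>0 \<le> \<kappa>"
begin

abbreviation "m1 \<equiv> mu1 q \<kappa>\<^sub>0 \<kappa>"
abbreviation "m2 \<equiv> mu2 q \<kappa>\<^sub>0 \<kappa>"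
abbreviation "m3 \<equiv> mu3 q \<kappa>\<^sub>0 \<kappa>"
abbreviation "m4 \<equiv> mu4 q \<kappa>\<^sub>0 \<kappa>"
abbreviation "r1 \<equiv> smallest_zero q \<kappa>\<^sub>0 m1"
abbreviation "r2 \<equiv> smallest_zero q \<kappa>\<^sub>0 m2"
abbreviation "r3 \<equiv> smallest_zero q \<kappa>\<^sub>0 m3"
abbreviation "r4 \<equiv> smallest_zero q \<kappa>\<^sub>0 m4"

section \<open>Signs, monotonicity and comparison of the functions \<open>mu1\<close> to
  \<open>mu4\<close>\<close>

lemma \<kappa>_pos: "0 < \<kappa>"
  using \<kappa> by simp

lemma powr_less_one:
  assumes "0 \<le> a" "a < (1 / \<kappa>\<^sub>0) powr (1 / q)"
  shows "\<kappa>\<^sub>0 * a powr q < 1"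
proof -
  have "a powr q < ((1 / \<kappa>\<^sub>0) powr (1 / q)) powr q"
    using assms q by (intro powr_less_mono2) auto
  also have "\<dots> = 1 / \<kappa>\<^sub>0"
    using \<kappa> q by (simp add: powr_powr)
  finally show ?thesis
    using \<kappa> by (simp add: field_simps)
qed

lemma powr_scaled_less_one:
  assumes "\<kappa>\<^sub>0 * a powr q < 1" "0 \<le> m" "m \<le> 1"
  shows "\<kappa>\<^sub>0 * m powr q * a powr q < 1"
proof -
  have "m powr q * (\<kappa>\<^sub>0 * a powr q) \<le> 1 * (\<kappa>\<^sub>0 * a powr q)"
    using assms q \<kappa> by (intro mult_right_mono powr_le1) auto
  then show ?thesis
    using assms(1) by (simp add: mult_ac)
qed

lemma m1_nonneg:
  assumes "\<kappa>\<^sub>0 * a powr q < 1"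
  shows "0 \<le> m1 a"
  unfolding mu1_def using assms q \<kappa>
  by (intro mult_nonneg_nonneg add_nonneg_nonneg divide_nonneg_nonneg) auto

lemma p_fun_less_one:
  assumes "\<kappa>\<^sub>0 * a powr q < 1" "m1 a \<le> 1"
  shows "p_fun q \<kappa>\<^sub>0 \<kappa> a < 1"
  unfolding p_fun_def by (intro powr_scaled_less_one m1_nonneg assms)

lemma m2_nonneg:
  assumes "\<kappa>\<^sub>0 * a powr q < 1" "m1 a \<le> 1"
  shows "0 \<le> m2 a"
  unfolding mu2_def using assms q \<kappa> p_fun_less_one[OF assms] m1_nonneg[OF assms(1)]
  by (intro mult_nonneg_nonneg add_nonneg_nonneg divide_nonneg_nonneg) auto

lemma mu_next_nonneg:
  assumes "\<kappa>\<^sub>0 * a powr q < 1" "m1 a \<le> 1" "0 \<le> m" "m \<le> 1"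
  shows "0 \<le> mu_next q \<kappa>\<^sub>0 \<kappa> m a"
  unfolding mu_next_def using assms q \<kappa> p_fun_less_one[OF assms(1,2)]
    m1_nonneg[OF assms(1)] powr_scaled_less_one[OF assms(1,3,4)]
  by (intro mult_nonneg_nonneg add_nonneg_nonneg divide_nonneg_nonneg) auto

text \<open>For fixed \<open>a\<close>, the argument \<open>m\<close> enters through
  \<open>s = m powr q\<close>: in numerators with positive coefficients, and in the denominator
  \<open>1 - \<kappa>\<^sub>0 * s * t\<close>, which shrinks but stays positive up to
  \<open>m = 1\<close>. So each of the three summands grows, and so does the outer factor
  \<open>m\<close>.\<close>

lemma mu_next_mono:
  assumes a: "\<kappa>\<^sub>0 * a powr q < 1" "m1 a \<le> 1" and mn: "0 \<le> m" "m \<le> n" "n \<le> 1"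
  shows "mu_next q \<kappa>\<^sub>0 \<kappa> m a \<le> mu_next q \<kappa>\<^sub>0 \<kappa> n a"
proof -
  define t s s' P where "t = a powr q" and "s = m powr q" and "s' = n powr q"
    and "P = 1 - p_fun q \<kappa>\<^sub>0 \<kappa> a"
  have s: "0 \<le> s" "s \<le> s'"
    unfolding s_def s'_def using mn q by (auto intro: powr_mono2)
  have t: "0 \<le> t" "0 < 1 - \<kappa>\<^sub>0 * t" and P: "0 < P"
    using a p_fun_less_one[OF a] by (auto simp: t_def P_def)
  have den: "0 < 1 - \<kappa>\<^sub>0 * s' * t" "1 - \<kappa>\<^sub>0 * s' * t \<le> 1 - \<kappa>\<^sub>0 * s * t"
    using powr_scaled_less_one[OF a(1), of n] mn s t \<kappa>
    by (auto simp: t_def s'_def intro!: mult_right_mono)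
  have st: "\<kappa> * s * t \<le> \<kappa> * s' * t" "\<kappa> * (m1 a powr q + s) * t \<le> \<kappa> * (m1 a powr q + s') * t"
    using s t \<kappa>_pos by (auto intro!: mult_right_mono)
  have B: "0 \<le> 1 + \<kappa>\<^sub>0 / (q + 1) * s * t"
      "1 + \<kappa>\<^sub>0 / (q + 1) * s * t \<le> 1 + \<kappa>\<^sub>0 / (q + 1) * s' * t"
    using s t \<kappa> q by (auto intro!: add_nonneg_nonneg divide_right_mono mult_right_mono)
  have nonneg: "0 \<le> \<kappa> * s' * t" "0 \<le> \<kappa> * (m1 a powr q + s') * t" "0 \<le> \<kappa> * s * t"
      "0 \<le> \<kappa> * (m1 a powr q + s) * t" "0 \<le> \<kappa> * (1 + m1 a powr q) * t"
    using s t \<kappa>_pos by auto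
  have 1: "\<kappa> * s * t / ((q + 1) * (1 - \<kappa>\<^sub>0 * s * t)) \<le> \<kappa> * s' * t / ((q + 1) * (1 - \<kappa>\<^sub>0 * s' * t))"
    using st nonneg den q by (intro frac_le mult_left_mono mult_pos_pos) auto
  have "\<kappa> * (m1 a powr q + s) * t / (1 - \<kappa>\<^sub>0 * s * t)
      \<le> \<kappa> * (m1 a powr q + s') * t / (1 - \<kappa>\<^sub>0 * s' * t)"
    using st nonneg den by (intro frac_le) auto
  then have 2: "\<kappa> * (m1 a powr q + s) * t / (1 - \<kappa>\<^sub>0 * s * t) * (1 / P) * (1 + \<kappa>\<^sub>0 / (q + 1) * s * t)
      \<le> \<kappa> * (m1 a powr q + s') * t / (1 - \<kappa>\<^sub>0 * s' * t) * (1 / P) * (1 + \<kappa>\<^sub>0 / (q + 1) * s' * t)"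
    by (intro mult_mono B mult_right_mono mult_nonneg_nonneg divide_nonneg_nonneg nonneg)
      (use P den in simp_all)
  have 3: "1 / (1 - \<kappa>\<^sub>0 * t) * (\<kappa> * (1 + m1 a powr q) * t / P) * (1 + \<kappa>\<^sub>0 / (q + 1) * s * t)
      \<le> 1 / (1 - \<kappa>\<^sub>0 * t) * (\<kappa> * (1 + m1 a powr q) * t / P) * (1 + \<kappa>\<^sub>0 / (q + 1) * s' * t)"
    by (intro mult_left_mono B mult_nonneg_nonneg divide_nonneg_nonneg nonneg)
      (use P t in simp_all)
  have "mu_next q \<kappa>\<^sub>0 \<kappa> m a = (\<kappa> * s * t / ((q + 1) * (1 - \<kappa>\<^sub>0 * s * t))
      + \<kappa> * (m1 a powr q + s) * t / (1 - \<kappa>\<^sub>0 * s * t) * (1 / P) * (1 + \<kappa>\<^sub>0 / (q + 1) * s * t)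
      + 1 / (1 - \<kappa>\<^sub>0 * t) * (\<kappa> * (1 + m1 a powr q) * t / P) * (1 + \<kappa>\<^sub>0 / (q + 1) * s * t)) * m"
    by (simp only: mu_next_def t_def s_def P_def)
  also have "\<dots> \<le> (\<kappa> * s' * t / ((q + 1) * (1 - \<kappa>\<^sub>0 * s' * t))
      + \<kappa> * (m1 a powr q + s') * t / (1 - \<kappa>\<^sub>0 * s' * t) * (1 / P) * (1 + \<kappa>\<^sub>0 / (q + 1) * s' * t)
      + 1 / (1 - \<kappa>\<^sub>0 * t) * (\<kappa> * (1 + m1 a powr q) * t / P) * (1 + \<kappa>\<^sub>0 / (q + 1) * s' * t)) * n"
  proof (rule mult_mono[OF add_mono[OF add_mono[OF 1 2] 3] mn(2) _ mn(1)])
    have B': "0 \<le> 1 + \<kappa>\<^sub>0 / (q + 1) * s' * t"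
      using B by linarith
    show "0 \<le> \<kappa> * s' * t / ((q + 1) * (1 - \<kappa>\<^sub>0 * s' * t))
      + \<kappa> * (m1 a powr q + s') * t / (1 - \<kappa>\<^sub>0 * s' * t) * (1 / P) * (1 + \<kappa>\<^sub>0 / (q + 1) * s' * t)
      + 1 / (1 - \<kappa>\<^sub>0 * t) * (\<kappa> * (1 + m1 a powr q) * t / P) * (1 + \<kappa>\<^sub>0 / (q + 1) * s' * t)"
      by (intro add_nonneg_nonneg[of "_ + _"] add_nonneg_nonneg[of "_ / _"] mult_nonneg_nonneg
          divide_nonneg_nonneg nonneg B') (use P t den q in simp_all)
  qed
  also have "\<dots> = mu_next q \<kappa>\<^sub>0 \<kappa> n a"
    by (simp only: mu_next_def t_def s'_def P_def)
  finally show ?thesis .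
qed

text \<open>At \<open>m = 1\<close> the first and third summands of the recursion add up to
  \<open>m2 a\<close>, and the middle one is nonnegative.\<close>

lemma m2_le_mu_next_one:
  assumes "\<kappa>\<^sub>0 * a powr q < 1" "m1 a \<le> 1"
  shows "m2 a \<le> mu_next q \<kappa>\<^sub>0 \<kappa> 1 a"
proof -
  note p_fun_less_one[OF assms]
  then have "0 \<le> \<kappa> * (m1 a powr q + 1) * a powr q / (1 - \<kappa>\<^sub>0 * a powr q)
          * (1 / (1 - p_fun q \<kappa>\<^sub>0 \<kappa> a)) * (1 + \<kappa>\<^sub>0 / (q + 1) * a powr q)"
    using assms q \<kappa>
    by (intro mult_nonneg_nonneg add_nonneg_nonneg divide_nonneg_nonneg) auto
  moreover have "mu_next q \<kappa>\<^sub>0 \<kappa> 1 a = m2 a + \<kappa> * (m1 a powr q + 1) * a powr q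
          / (1 - \<kappa>\<^sub>0 * a powr q) * (1 / (1 - p_fun q \<kappa>\<^sub>0 \<kappa> a)) * (1 + \<kappa>\<^sub>0 / (q + 1) * a powr q)"
    unfolding mu_next_def mu2_def
    by (simp add: algebra_simps add_divide_distrib)
  ultimately show ?thesis
    by simp
qed

text \<open>This places the zero for \<open>m2\<close> no further out than that for
  \<open>m1\<close>. When \<open>m1 a = 1\<close>, \<open>p_fun\<close> reduces to
  \<open>\<kappa>\<^sub>0 * t\<close>, and the bracket in \<open>m2\<close> arises from the one in
  \<open>m1\<close> by replacing the factor \<open>1 / 2\<close> with
  \<open>2 * \<kappa> * t / (1 - \<kappa>\<^sub>0 * t)\<close>. It suffices that the new factor is
  at least \<open>1 / 2\<close>, that is
  \<open>1 - \<kappa>\<^sub>0 * t \<le> 4 * \<kappa> * t\<close>, and this follows from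
  \<open>m1 a = 1\<close> with \<open>\<kappa>\<^sub>0 \<le> \<kappa>\<close>.\<close>

lemma m2_ge_one:
  assumes "\<kappa>\<^sub>0 * a powr q < 1" "m1 a = 1"
  shows "1 \<le> m2 a"
proof -
  define t where "t = a powr q"
  have t: "0 \<le> t" "\<kappa>\<^sub>0 * t < 1"
    using assms by (auto simp: t_def)
  have eq: "\<kappa> * t / (q + 1) + (1 + \<kappa>\<^sub>0 / (q + 1) * t) / 2 = 1 - \<kappa>\<^sub>0 * t"
    using assms t by (simp add: mu1_def t_def)
  moreover have "2 * (q + 1) * (\<kappa> * t / (q + 1) + (1 + \<kappa>\<^sub>0 / (q + 1) * t) / 2)
      = 2 * \<kappa> * t + (q + 1 + \<kappa>\<^sub>0 * t)"
    using q by (simp add: divide_simps) (simp add: algebra_simps)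
  ultimately have "2 * \<kappa> * t + (q + 1 + \<kappa>\<^sub>0 * t) = 2 * (q + 1) * (1 - \<kappa>\<^sub>0 * t)"
    by simp
  then have "(q + 1) * (1 - \<kappa>\<^sub>0 * t) = 2 * \<kappa> * t + \<kappa>\<^sub>0 * t + (q + 1) * (\<kappa>\<^sub>0 * t)"
    by (simp add: algebra_simps)
  also have "\<dots> \<le> (q + 1) * (4 * \<kappa> * t)"
  proof -
    \<comment> \<open>This is the right side minus the left side, regrouped through
      \<open>\<kappa> - \<kappa>\<^sub>0\<close> so that every term is visibly nonnegative.\<close>
    have "0 \<le> (3 * q + 1) * ((\<kappa> - \<kappa>\<^sub>0) * t) + 2 * q * (\<kappa>\<^sub>0 * t) + q * (\<kappa> * t) + (\<kappa> - \<kappa>\<^sub>0) * t"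
      using q \<kappa> t by (intro add_nonneg_nonneg mult_nonneg_nonneg) auto
    then show ?thesis
      by (simp add: algebra_simps)
  qed
  finally have "1 - \<kappa>\<^sub>0 * t \<le> 4 * \<kappa> * t"
    using q by simp
  then have "1 / 2 \<le> 2 * \<kappa> * t / (1 - \<kappa>\<^sub>0 * t)"
    using t by (simp add: field_simps)
  then have "(1 + \<kappa>\<^sub>0 / (q + 1) * t) * (1 / 2)
      \<le> (1 + \<kappa>\<^sub>0 / (q + 1) * t) * (2 * \<kappa> * t / (1 - \<kappa>\<^sub>0 * t))"
    using t q \<kappa> by (intro mult_left_mono) auto
  then have "1 - \<kappa>\<^sub>0 * t \<le> \<kappa> * t / (q + 1) +
      (1 + \<kappa>\<^sub>0 / (q + 1) * t) * (2 * \<kappa> * t / (1 - \<kappa>\<^sub>0 * t))"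
    using eq by linarith
  also have "\<dots> = \<kappa> * t / (q + 1) +
      \<kappa> * (1 + 1) * (\<kappa>\<^sub>0 / (q + 1) * t + 1) * t / (1 - \<kappa>\<^sub>0 * t)"
    by (simp add: mult_ac add.commute)
  finally have "1 - \<kappa>\<^sub>0 * t \<le> \<kappa> * t / (q + 1) +
      \<kappa> * (1 + 1) * (\<kappa>\<^sub>0 / (q + 1) * t + 1) * t / (1 - \<kappa>\<^sub>0 * t)" .
  moreover have "p_fun q \<kappa>\<^sub>0 \<kappa> a = \<kappa>\<^sub>0 * t"
    using assms by (simp add: p_fun_def t_def)
  ultimately show ?thesis
    using t assms(2) by (simp add: mu2_def flip: t_def)
qed

section \<open>Continuity away from the singularities\<close>

lemma continuous_on_powr_q:
  assumes "continuous_on S f" "\<And>a. a \<in> S \<Longrightarrow> 0 \<le> f a"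
  shows "continuous_on S (\<lambda>a. f a powr q)"
  using assms q by (intro continuous_on_powr' continuous_on_const) auto

lemma continuous_on_m1:
  assumes "S \<subseteq> {0..}" "\<And>a. a \<in> S \<Longrightarrow> \<kappa>\<^sub>0 * a powr q < 1"
  shows "continuous_on S m1"
proof -
  have pow: "continuous_on S (\<lambda>a. a powr q)"
    using assms(1) by (intro continuous_on_powr_q continuous_on_id) auto
  have ne: "1 - \<kappa>\<^sub>0 * a powr q \<noteq> 0" if "a \<in> S" for a
    using assms(2)[OF that] by simp
  show ?thesis
    unfolding mu1_def using q
    by (intro continuous_on_mult continuous_on_add continuous_on_divide continuous_on_diff
        continuous_on_const pow ballI ne) simp_all
qed

lemma continuous_on_p_fun:
  assumes "S \<subseteq> {0..}" "\<And>a. a \<in> S \<Longrightarrow> \<kappa>\<^sub>0 * a powr q < 1"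
  shows "continuous_on S (p_fun q \<kappa>\<^sub>0 \<kappa>)"
  unfolding p_fun_def using assms(1)
  by (intro continuous_on_mult continuous_on_const continuous_on_powr_q continuous_on_m1
      m1_nonneg continuous_on_id assms) auto

lemma continuous_on_m2:
  assumes "S \<subseteq> {0..}" "\<And>a. a \<in> S \<Longrightarrow> \<kappa>\<^sub>0 * a powr q < 1" "\<And>a. a \<in> S \<Longrightarrow> m1 a \<le> 1"
  shows "continuous_on S m2"
proof -
  have pow: "continuous_on S (\<lambda>a. a powr q)" "continuous_on S (\<lambda>a. m1 a powr q)"
    using assms by (intro continuous_on_powr_q continuous_on_id continuous_on_m1 m1_nonneg; auto)+
  have p: "continuous_on S (\<lambda>a. p_fun q \<kappa>\<^sub>0 \<kappa> a)"
    using assms by (intro continuous_on_p_fun)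
  have ne: "1 - p_fun q \<kappa>\<^sub>0 \<kappa> a \<noteq> 0" "1 - \<kappa>\<^sub>0 * a powr q \<noteq> 0" if "a \<in> S" for a
    using assms(2)[OF that] p_fun_less_one[OF assms(2,3)[OF that]] by simp_all
  show ?thesis
    unfolding mu2_def using q
    by (intro continuous_on_mult continuous_on_add continuous_on_divide continuous_on_diff
        continuous_on_const pow p ballI ne) simp_all
qed

text \<open>The bounds by 1 on \<open>m1 a\<close> and \<open>m a\<close> keep both inner
  denominators positive. Continuity of \<open>m3\<close> and \<open>m4\<close> is thus available up
  to the smallest zero for the preceding function, which is the interval where the next zero is
  sought.\<close>

lemma continuous_on_mu_next:
  assumes "S \<subseteq> {0..}" "\<And>a. a \<in> S \<Longrightarrow> \<kappa>\<^sub>0 * a powr q < 1" "\<And>a. a \<in> S \<Longrightarrow> m1 a \<le> 1"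
    and m: "continuous_on S m" "\<And>a. a \<in> S \<Longrightarrow> 0 \<le> m a" "\<And>a. a \<in> S \<Longrightarrow> m a \<le> 1"
  shows "continuous_on S (\<lambda>a. mu_next q \<kappa>\<^sub>0 \<kappa> (m a) a)"
proof -
  have pow: "continuous_on S (\<lambda>a. a powr q)" "continuous_on S (\<lambda>a. m1 a powr q)"
    "continuous_on S (\<lambda>a. m a powr q)"
    using assms by (intro continuous_on_powr_q continuous_on_id continuous_on_m1 m1_nonneg; auto)+
  have p: "continuous_on S (\<lambda>a. p_fun q \<kappa>\<^sub>0 \<kappa> a)"
    using assms by (intro continuous_on_p_fun)
  have ne: "1 - p_fun q \<kappa>\<^sub>0 \<kappa> a \<noteq> 0" "1 - \<kappa>\<^sub>0 * a powr q \<noteq> 0"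
    "1 - \<kappa>\<^sub>0 * m a powr q * a powr q \<noteq> 0" "(q + 1) * (1 - \<kappa>\<^sub>0 * m a powr q * a powr q) \<noteq> 0"
    if "a \<in> S" for a
    using assms(2)[OF that] p_fun_less_one[OF assms(2,3)[OF that]]
      powr_scaled_less_one[OF assms(2) m(2,3), OF that that that] q by simp_all
  show ?thesis
    unfolding mu_next_def using q
    by (intro continuous_on_mult continuous_on_add continuous_on_divide continuous_on_diff
        continuous_on_const pow p m(1) ballI ne) simp_all
qed

section \<open>Existence and ordering of the four smallest zeros\<close>

lemma m1_at_0 [simp]: "m1 0 = 1 / 2"
  by (simp add: mu1_def)

lemma m2_at_0 [simp]: "m2 0 = 0"
  by (simp add: mu2_def)

lemma mu_next_at_0 [simp]: "mu_next q \<kappa>\<^sub>0 \<kappa> m 0 = 0"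
  by (simp add: mu_next_def)

lemma r1:
  shows "0 < r1" and "r1 < (1 / \<kappa>\<^sub>0) powr (1 / q)" and "m1 r1 = 1"
    and "\<And>a. 0 \<le> a \<Longrightarrow> a < r1 \<Longrightarrow> m1 a < 1"
proof -
  \<comment> \<open>Chosen so that \<open>\<kappa>\<^sub>0 * s powr q = 1 / 2\<close>: the prefactor
    of \<open>m1\<close> is then 2 and turns the constant \<open>1 / 2\<close> in the bracket into
    1, while the other terms are nonnegative. Hence \<open>m1 s\<close> is at least 1.\<close>
  define s where "s = (1 / (2 * \<kappa>\<^sub>0)) powr (1 / q)"
  have s: "0 \<le> s" "s < (1 / \<kappa>\<^sub>0) powr (1 / q)"
    using \<kappa> q by (auto simp: s_def field_simps intro!: powr_less_mono2)
  have "s powr q = 1 / (2 * \<kappa>\<^sub>0)"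
    using \<kappa> q by (simp add: s_def powr_powr)
  then have half: "1 - \<kappa>\<^sub>0 * s powr q = 1 / 2"
    using \<kappa> by simp
  moreover have "0 \<le> \<kappa> * s powr q / (q + 1)" "0 \<le> \<kappa>\<^sub>0 / (q + 1) * s powr q"
    using \<kappa> q by auto
  moreover have "1 \<le> 1 / (1 / 2) * (u + (1 + v) / 2)" if "0 \<le> u" "0 \<le> v" for u v :: real
    using that by (simp add: field_simps)
  ultimately have "1 \<le> m1 s"
    unfolding mu1_def half by blast
  moreover have "continuous_on {0..s} m1"
    using s by (intro continuous_on_m1 powr_less_one) auto
  ultimately show "0 < r1" "r1 < (1 / \<kappa>\<^sub>0) powr (1 / q)" "m1 r1 = 1"
    "\<And>a. 0 \<le> a \<Longrightarrow> a < r1 \<Longrightarrow> m1 a < 1"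
    using smallest_zero_properties[of s m1 \<kappa>\<^sub>0 q] s by auto
qed

text \<open>The end point is included, thanks to \<open>m1 r1 = 1\<close>, because the next zero is
  sought on the closed interval [0,\<open>r1\<close>]. The same holds for the two analogues
  below.\<close>

lemma below_r1:
  assumes "0 \<le> a" "a \<le> r1"
  shows "\<kappa>\<^sub>0 * a powr q < 1" "m1 a \<le> 1"
  using powr_less_one[of a] r1 assms by (auto simp: order.order_iff_strict)

lemma r2:
  shows "0 < r2" and "r2 \<le> r1" and "m2 r2 = 1" and "\<And>a. 0 \<le> a \<Longrightarrow> a < r2 \<Longrightarrow> m2 a < 1"
proof -
  have "1 \<le> m2 r1"
    using r1 by (intro m2_ge_one powr_less_one) auto
  moreover have "continuous_on {0..r1} m2"
    by (intro continuous_on_m2 below_r1) auto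
  ultimately show "0 < r2" "r2 \<le> r1" "m2 r2 = 1" "\<And>a. 0 \<le> a \<Longrightarrow> a < r2 \<Longrightarrow> m2 a < 1"
    using smallest_zero_properties[of r1 m2 \<kappa>\<^sub>0 q] r1 by auto
qed

lemma below_r2:
  assumes "0 \<le> a" "a \<le> r2"
  shows "\<kappa>\<^sub>0 * a powr q < 1" "m1 a \<le> 1" "0 \<le> m2 a" "m2 a \<le> 1"
  using below_r1[of a] m2_nonneg[of a] r2 assms by (auto simp: order.order_iff_strict)

lemma continuous_on_m3: "continuous_on {0..r2} m3"
  unfolding mu3_def by (intro continuous_on_mu_next continuous_on_m2 below_r2) auto

text \<open>At \<open>r2\<close> the inner value is \<open>m2 r2 = 1\<close>, so
  \<open>m3 r2\<close> is the recursion at 1, which dominates \<open>m2 r2\<close>. Level 1 is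
  therefore reached no later than \<open>r2\<close>.\<close>

lemma r3:
  shows "0 < r3" and "r3 \<le> r2" and "m3 r3 = 1" and "\<And>a. 0 \<le> a \<Longrightarrow> a < r3 \<Longrightarrow> m3 a < 1"
proof -
  have "1 \<le> m3 r2"
    using m2_le_mu_next_one[of r2] below_r2[of r2] r2 by (simp add: mu3_def)
  moreover have "m3 0 < 1"
    by (simp add: mu3_def)
  ultimately show "0 < r3" "r3 \<le> r2" "m3 r3 = 1" "\<And>a. 0 \<le> a \<Longrightarrow> a < r3 \<Longrightarrow> m3 a < 1"
    using smallest_zero_properties[of r2 m3 \<kappa>\<^sub>0 q] continuous_on_m3 r1 r2 by auto
qed

lemma below_r3:
  assumes "0 \<le> a" "a \<le> r3"
  shows "\<kappa>\<^sub>0 * a powr q < 1" "m1 a \<le> 1" "0 \<le> m2 a" "m2 a \<le> 1" "0 \<le> m3 a" "m3 a \<le> 1"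
proof -
  have a: "a \<le> r2"
    using assms r3(2) by simp
  note below = below_r2[OF assms(1) a]
  show "\<kappa>\<^sub>0 * a powr q < 1" "m1 a \<le> 1" "0 \<le> m2 a" "m2 a \<le> 1"
    by (fact below)+
  show "0 \<le> m3 a"
    unfolding mu3_def by (rule mu_next_nonneg[OF below])
  show "m3 a \<le> 1"
  proof (cases "a = r3")
    case True
    then show ?thesis
      using r3(3) by simp
  next
    case False
    then show ?thesis
      using r3(4)[of a] assms by simp
  qed
qed

lemma continuous_on_m4: "continuous_on {0..r3} m4"
  unfolding mu4_def
proof (rule continuous_on_mu_next)
  show "continuous_on {0..r3} m3"
    by (rule continuous_on_subset[OF continuous_on_m3]) (use r3(2) in auto)
qed (auto intro: below_r3)

text \<open>At \<open>r3\<close> the inner value for \<open>m4\<close> is 1, while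
  \<open>m3 r3\<close> is the same recursion at \<open>m2 r3 \<le> 1\<close>. Monotonicity gives
  \<open>m4 r3 \<ge> m3 r3 = 1\<close>.\<close>

lemma r4:
  shows "0 < r4" and "r4 \<le> r3" and "m4 r4 = 1" and "\<And>a. 0 \<le> a \<Longrightarrow> a < r4 \<Longrightarrow> m4 a < 1"
proof -
  have "m3 r3 = mu_next q \<kappa>\<^sub>0 \<kappa> (m2 r3) r3"
    by (rule mu3_def)
  also have "\<dots> \<le> mu_next q \<kappa>\<^sub>0 \<kappa> 1 r3"
    using r3(1) by (intro mu_next_mono below_r3) auto
  finally have "1 \<le> m4 r3"
    by (simp add: mu4_def r3(3))
  moreover have "m4 0 < 1"
    by (simp add: mu4_def)
  ultimately show "0 < r4" "r4 \<le> r3" "m4 r4 = 1" "\<And>a. 0 \<le> a \<Longrightarrow> a < r4 \<Longrightarrow> m4 a < 1"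
    using smallest_zero_properties[of r3 m4 \<kappa>\<^sub>0 q] continuous_on_m4 r1(2) r2(2) r3(1,2) by auto
qed

lemma rho_eq: "rho q \<kappa>\<^sub>0 \<kappa> = r4"
  unfolding rho_def using r2(2) r3(2) r4(2) by simp

lemma below_rho:
  assumes "0 \<le> a" "a < rho q \<kappa>\<^sub>0 \<kappa>"
  shows "\<kappa>\<^sub>0 * a powr q < 1"
    and "0 \<le> m1 a" "m1 a \<le> 1" "0 \<le> m2 a" "m2 a \<le> 1"
    and "0 \<le> m3 a" "m3 a \<le> 1" "0 \<le> m4 a" "m4 a < 1"
proof -
  have a: "a \<le> r3" "a < r4"
    using assms r4(2) by (auto simp: rho_eq)
  note below = below_r3[OF assms(1) a(1)]
  show "\<kappa>\<^sub>0 * a powr q < 1" "m1 a \<le> 1" "0 \<le> m2 a" "m2 a \<le> 1" "0 \<le> m3 a" "m3 a \<le> 1"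
    by (fact below)+
  show "0 \<le> m1 a"
    by (rule m1_nonneg[OF below(1)])
  show "0 \<le> m4 a"
    unfolding mu4_def by (rule mu_next_nonneg[OF below(1,2,5,6)])
  show "m4 a < 1"
    by (rule r4(4)[OF assms(1) a(2)])
qed

text \<open>The continuous function \<open>m4\<close> attains its maximum on [0,\<open>e\<close>] at
  a point still below the radius, where its value is less than 1.\<close>

lemma m4_contraction:
  assumes "0 \<le> e" "e < rho q \<kappa>\<^sub>0 \<kappa>"
  obtains c where "0 \<le> c" "c < 1" "\<And>a. 0 \<le> a \<Longrightarrow> a \<le> e \<Longrightarrow> m4 a \<le> c"
proof -
  have "continuous_on {0..e} m4"
    by (rule continuous_on_subset[OF continuous_on_m4]) (use assms r4 rho_eq in auto)
  then obtain b where "b \<in> {0..e}" "\<And>a. a \<in> {0..e} \<Longrightarrow> m4 a \<le> m4 b"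
    using continuous_attains_sup[of "{0..e}" m4] assms by auto
  then show thesis
    using that[of "m4 b"] below_rho[of b] assms by auto
qed

end

section \<open>One step of the iteration\<close>

locale holder_operator = holder_constants q \<kappa>\<^sub>0 \<kappa> for q \<kappa>\<^sub>0 \<kappa> :: real +
  fixes T :: "'a::banach \<Rightarrow> 'b::banach" and T' :: "'a \<Rightarrow> 'a \<Rightarrow>\<^sub>L 'b"
    and D :: "'a set" and xs :: 'a
  assumes convex_D: "convex D"
    and deriv: "\<And>u. u \<in> D \<Longrightarrow> (T has_derivative blinfun_apply (T' u)) (at u)"
    and xs: "xs \<in> D" and T_xs: "T xs = 0" and invertible_xs: "blinfun_invertible (T' xs)"
    and center: "\<And>u. u \<in> D \<Longrightarrow>
      norm (blinfun_inv (T' xs) o\<^sub>L (T' u - T' xs)) \<le> \<kappa>\<^sub>0 * norm (u - xs) powr q"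
    and holder: "\<And>u v. u \<in> D \<Longrightarrow> v \<in> D \<Longrightarrow>
      norm (blinfun_inv (T' xs) o\<^sub>L (T' u - T' v)) \<le> \<kappa> * norm (u - v) powr q"
begin

section \<open>Estimates for the operator at one or two given points\<close>

abbreviation "A \<equiv> blinfun_inv (T' xs)"

text \<open>Here and below a majorant \<open>d\<close> replaces the exact distance to
  \<open>xs\<close>, since for the substeps only bounds of the form \<open>m * e\<close> are
  known.\<close>

lemma center_le:
  assumes "u \<in> D" "norm (u - xs) \<le> d"
  shows "norm (A o\<^sub>L (T' u - T' xs)) \<le> \<kappa>\<^sub>0 * d powr q"
proof -
  have "\<kappa>\<^sub>0 * norm (u - xs) powr q \<le> \<kappa>\<^sub>0 * d powr q"
    using assms q \<kappa> by (intro mult_left_mono powr_mono2) auto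
  then show ?thesis
    using center[OF assms(1)] by linarith
qed

lemma
  assumes "u \<in> D" "norm (u - xs) \<le> d" "\<kappa>\<^sub>0 * d powr q < 1"
  shows invertible: "blinfun_invertible (T' u)"
    and norm_inv_le: "norm (blinfun_inv (T' u) w) \<le> norm (A w) / (1 - \<kappa>\<^sub>0 * d powr q)"
  using blinfun_invertible_perturbation[OF invertible_xs center_le[OF assms(1,2)] assms(3)]
  by auto

text \<open>The distance from \<open>u\<close> to \<open>v\<close> is routed through
  \<open>xs\<close>, and subadditivity of the power splits the Hoelder bound into the contributions
  of \<open>d\<close> and \<open>e\<close>.\<close>

lemma norm_inv_diff_le:
  assumes u: "u \<in> D" "norm (u - xs) \<le> d" "\<kappa>\<^sub>0 * d powr q < 1"
    and v: "v \<in> D" "norm (v - xs) \<le> e" "\<kappa>\<^sub>0 * e powr q < 1"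
  shows "norm (blinfun_inv (T' u) w - blinfun_inv (T' v) w)
    \<le> \<kappa> * (d powr q + e powr q) / ((1 - \<kappa>\<^sub>0 * d powr q) * (1 - \<kappa>\<^sub>0 * e powr q)) * norm (A w)"
proof (rule norm_blinfun_inv_diff_le[OF invertible_xs])
  have d: "0 \<le> d" "0 \<le> e"
    using u(2) v(2) norm_ge_zero order_trans by blast+
  have "norm (u - v) \<le> d + e"
    using norm_triangle_ineq4[of "u - xs" "v - xs"] u(2) v(2) by simp
  then have "norm (u - v) powr q \<le> (d + e) powr q"
    using q by (intro powr_mono2) auto
  also have "\<dots> \<le> d powr q + e powr q"
    using d q by (intro powr_add_le_add_powr) auto
  finally have "\<kappa> * norm (u - v) powr q \<le> \<kappa> * (d powr q + e powr q)"
    using \<kappa>_pos by simp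
  then show "norm (A o\<^sub>L (T' u - T' v)) \<le> \<kappa> * (d powr q + e powr q)"
    using holder[OF u(1) v(1)] by linarith
qed (use assms center_le in auto)

text \<open>The remainder at base point \<open>xs\<close>, where \<open>T\<close> vanishes and
  \<open>A\<close> inverts the derivative. It serves twice: to bound \<open>A (T u)\<close> from
  above, and to exclude further zeros.\<close>

lemma linearization_le:
  assumes "u \<in> D"
  shows "norm (A (T u) - (u - xs)) \<le> \<kappa>\<^sub>0 / (q + 1) * norm (u - xs) powr q * norm (u - xs)"
  using holder_remainder_bound[OF convex_D q(1) deriv center xs assms] invertible_xs
  by (simp add: T_xs blinfun.diff_right)

lemma norm_A_T_le:
  assumes "u \<in> D" "norm (u - xs) \<le> d"
  shows "norm (A (T u)) \<le> (1 + \<kappa>\<^sub>0 / (q + 1) * d powr q) * d"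
proof -
  have d: "0 \<le> d"
    using assms(2) norm_ge_zero order_trans by blast
  have "norm (A (T u)) \<le> norm (u - xs) + norm (A (T u) - (u - xs))"
    by (rule norm_triangle_sub)
  also have "norm (A (T u) - (u - xs)) \<le> \<kappa>\<^sub>0 / (q + 1) * norm (u - xs) powr q * norm (u - xs)"
    by (rule linearization_le[OF assms(1)])
  also have "\<dots> \<le> \<kappa>\<^sub>0 / (q + 1) * d powr q * d"
    using assms d q \<kappa> by (intro mult_mono powr_mono2) auto
  finally show ?thesis
    using assms(2) by (simp add: algebra_simps)
qed

text \<open>The Newton error equals the inverse of \<open>T' u\<close> applied to the remainder of
  \<open>T\<close> expanded at \<open>u\<close> and evaluated at \<open>xs\<close>. As the base
  point is \<open>u\<close> and not \<open>xs\<close>, the numerator carries \<open>\<kappa>\<close>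
  while the inverse contributes \<open>\<kappa>\<^sub>0\<close>.\<close>

lemma newton_le:
  assumes "u \<in> D" "norm (u - xs) \<le> d" "\<kappa>\<^sub>0 * d powr q < 1"
  shows "norm (u - blinfun_inv (T' u) (T u) - xs)
    \<le> \<kappa> * d powr q / ((q + 1) * (1 - \<kappa>\<^sub>0 * d powr q)) * d"
proof -
  have d: "0 \<le> d"
    using assms(2) norm_ge_zero order_trans by blast
  define w where "w = T xs - T u - T' u (xs - u)"
  have "u - blinfun_inv (T' u) (T u) - xs = blinfun_inv (T' u) w"
    using invertible[OF assms] by (simp add: w_def T_xs blinfun.diff_right blinfun.minus_right)
  then have "norm (u - blinfun_inv (T' u) (T u) - xs) \<le> norm (A w) / (1 - \<kappa>\<^sub>0 * d powr q)"
    using norm_inv_le[OF assms, of w] by simp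
  also have "\<dots> \<le> (\<kappa> / (q + 1) * d powr q * d) / (1 - \<kappa>\<^sub>0 * d powr q)"
  proof (rule divide_right_mono)
    have "norm (A w) \<le> \<kappa> / (q + 1) * norm (xs - u) powr q * norm (xs - u)"
      unfolding w_def
      by (rule holder_remainder_bound[OF convex_D q(1) deriv holder[OF _ assms(1)] assms(1) xs])
    also have "\<dots> \<le> \<kappa> / (q + 1) * d powr q * d"
      using assms d q \<kappa>_pos by (intro mult_mono powr_mono2) (auto simp: norm_minus_commute)
    finally show "norm (A w) \<le> \<kappa> / (q + 1) * d powr q * d" .
  qed (use assms in simp)
  finally show ?thesis
    by (simp add: divide_simps)
qed

section \<open>Error bounds for the four substeps from a fixed iterate\<close>

context
  fixes x :: 'a
  assumes ball_D: "ball xs (rho q \<kappa>\<^sub>0 \<kappa>) \<subseteq> D"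
    and x_rho: "norm (x - xs) < rho q \<kappa>\<^sub>0 \<kappa>"
begin

private abbreviation "e \<equiv> norm (x - xs)"
private abbreviation "y \<equiv> y_step T T' x"

lemmas mu_bounds = below_rho[OF norm_ge_zero x_rho]

text \<open>Turns the error bound of one substep into admissibility of its result for the next,
  which is how well-definedness is propagated.\<close>

lemma scaled_in_D:
  assumes "norm (u - xs) \<le> m * e" "m \<le> 1"
  shows "u \<in> D" and "norm (u - xs) < rho q \<kappa>\<^sub>0 \<kappa>"
proof -
  have "m * e \<le> e"
    using mult_right_mono[OF assms(2) norm_ge_zero, of "x - xs"] by simp
  then show "norm (u - xs) < rho q \<kappa>\<^sub>0 \<kappa>"
    using assms x_rho by linarith
  then show "u \<in> D"
    using ball_D by (auto simp: dist_norm norm_minus_commute)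
qed

lemma scaled_powr: "0 \<le> m \<Longrightarrow> (m * e) powr q = m powr q * e powr q"
  by (simp add: powr_mult)

lemma scaled_less_one:
  assumes "0 \<le> m" "m \<le> 1"
  shows "\<kappa>\<^sub>0 * (m * e) powr q < 1"
  using powr_scaled_less_one[OF mu_bounds(1) assms] assms by (simp add: scaled_powr mult_ac)

lemma x_in_D: "x \<in> D"
  using scaled_in_D[of x 1] by simp

text \<open>Half a Newton step is a full one plus half of the Newton increment; these two parts give
  the two summands of \<open>m1\<close>.\<close>

lemma norm_y_le: "norm (y - xs) \<le> m1 e * e"
proof -
  define t where "t = e powr q"
  have t: "0 < 1 - \<kappa>\<^sub>0 * t"
    using mu_bounds(1) by (simp add: t_def)
  define w where "w = blinfun_inv (T' x) (T x)"
  have eq: "y - xs = (x - w - xs) + (1 / 2) *\<^sub>R w"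
    by (simp add: y_step_def w_def algebra_simps flip: scaleR_left.add)
  have "norm (y - xs) \<le> norm (x - w - xs) + norm w / 2"
    unfolding eq by (rule order_trans[OF norm_triangle_ineq]) simp
  also have "norm (x - w - xs) \<le> \<kappa> * t / ((q + 1) * (1 - \<kappa>\<^sub>0 * t)) * e"
    unfolding w_def t_def using mu_bounds(1) by (intro newton_le x_in_D) auto
  also have "norm w \<le> norm (A (T x)) / (1 - \<kappa>\<^sub>0 * t)"
    unfolding w_def t_def using mu_bounds(1) by (intro norm_inv_le x_in_D) auto
  also have "norm (A (T x)) \<le> (1 + \<kappa>\<^sub>0 / (q + 1) * t) * e"
    unfolding t_def by (intro norm_A_T_le x_in_D) auto
  finally have "norm (y - xs) \<le> \<kappa> * t / ((q + 1) * (1 - \<kappa>\<^sub>0 * t)) * e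
      + (1 + \<kappa>\<^sub>0 / (q + 1) * t) * e / (1 - \<kappa>\<^sub>0 * t) / 2"
    using t by (simp add: divide_right_mono)
  also have "\<dots> = m1 e * e"
    unfolding mu1_def t_def[symmetric] using t q by (simp add: divide_simps) (simp add: algebra_simps)
  finally show ?thesis .
qed

text \<open>Domain membership, distance bound and smallness, in the order in which the single-point
  estimates take them as premises.\<close>

lemmas y_near = scaled_in_D(1)[OF norm_y_le mu_bounds(3)] norm_y_le
  scaled_less_one[OF mu_bounds(2,3)]
lemmas x_near = x_in_D order_refl[of e] mu_bounds(1)

text \<open>The difference bound with distances \<open>e\<close> and \<open>m1 e * e\<close>. The
  denominator \<open>1 - p_fun q \<kappa>\<^sub>0 \<kappa> e\<close> is exactly the perturbation
  factor at \<open>y\<close>.\<close>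

lemma norm_inv_xy_diff_le:
  "norm (blinfun_inv (T' x) w - blinfun_inv (T' y) w)
    \<le> 1 / (1 - \<kappa>\<^sub>0 * e powr q) * (\<kappa> * (1 + m1 e powr q) * e powr q / (1 - p_fun q \<kappa>\<^sub>0 \<kappa> e))
      * norm (A w)"
proof -
  have "\<kappa> * (e powr q + (m1 e * e) powr q)
        / ((1 - \<kappa>\<^sub>0 * e powr q) * (1 - \<kappa>\<^sub>0 * (m1 e * e) powr q))
      = 1 / (1 - \<kappa>\<^sub>0 * e powr q) * (\<kappa> * (1 + m1 e powr q) * e powr q / (1 - p_fun q \<kappa>\<^sub>0 \<kappa> e))"
    by (simp only: times_divide_times_eq scaled_powr[OF mu_bounds(2)] p_fun_def)
      (simp add: distrib_left distrib_right mult_ac)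
  then show ?thesis
    using norm_inv_diff_le[OF x_near y_near, of w] by simp
qed

text \<open>The substep is a Newton step at \<open>x\<close> with the inverse taken at
  \<open>y\<close>: the Newton error and the difference of the two inverses on \<open>T x\<close>
  give the two summands of \<open>m2\<close>.\<close>

lemma norm_z1_le: "norm (z1_step T T' x - xs) \<le> m2 e * e"
proof -
  define t where "t = e powr q"
  have t: "0 < 1 - \<kappa>\<^sub>0 * t"
    using mu_bounds(1) by (simp add: t_def)
  have p: "0 < 1 - p_fun q \<kappa>\<^sub>0 \<kappa> e"
    using p_fun_less_one[OF mu_bounds(1,3)] by simp
  define c where "c = 1 / (1 - \<kappa>\<^sub>0 * t) * (\<kappa> * (1 + m1 e powr q) * t / (1 - p_fun q \<kappa>\<^sub>0 \<kappa> e))"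
  have c: "0 \<le> c"
    unfolding c_def using t p \<kappa>_pos
    by (intro mult_nonneg_nonneg divide_nonneg_nonneg) (auto simp: t_def)
  have "z1_step T T' x - xs = (x - blinfun_inv (T' x) (T x) - xs)
      + (blinfun_inv (T' x) (T x) - blinfun_inv (T' y) (T x))"
    by (simp add: z1_step_def)
  then have "norm (z1_step T T' x - xs) \<le> norm (x - blinfun_inv (T' x) (T x) - xs)
      + norm (blinfun_inv (T' x) (T x) - blinfun_inv (T' y) (T x))"
    by (metis norm_triangle_ineq)
  also have "norm (x - blinfun_inv (T' x) (T x) - xs) \<le> \<kappa> * t / ((q + 1) * (1 - \<kappa>\<^sub>0 * t)) * e"
    unfolding t_def by (rule newton_le[OF x_near])
  also have "norm (blinfun_inv (T' x) (T x) - blinfun_inv (T' y) (T x)) \<le> c * norm (A (T x))"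
    unfolding c_def t_def by (rule norm_inv_xy_diff_le)
  also have "norm (A (T x)) \<le> (1 + \<kappa>\<^sub>0 / (q + 1) * t) * e"
    unfolding t_def by (intro norm_A_T_le x_in_D) auto
  finally have "norm (z1_step T T' x - xs)
      \<le> \<kappa> * t / ((q + 1) * (1 - \<kappa>\<^sub>0 * t)) * e + c * ((1 + \<kappa>\<^sub>0 / (q + 1) * t) * e)"
    using c by (simp add: mult_left_mono)
  also have "\<dots> = m2 e * e"
    unfolding mu2_def c_def t_def[symmetric] using t p q
    by (simp add: divide_simps) (simp add: algebra_simps)
  finally show ?thesis .
qed

text \<open>Covers the last two substeps at once, as they apply the same correction to different
  points. The new error is the Newton error at \<open>u\<close>, plus the difference of the inverses
  at \<open>u\<close> and \<open>y\<close>, plus that of the inverses at \<open>x\<close> and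
  \<open>y\<close>, both applied to \<open>T u\<close>; these match the three summands of
  \<open>mu_next\<close>.\<close>

lemma norm_correction_le:
  assumes u: "norm (u - xs) \<le> m * e" and m: "0 \<le> m" "m \<le> 1"
  shows "norm (u - (2 *\<^sub>R blinfun_inv (T' y) - blinfun_inv (T' x)) (T u) - xs)
    \<le> mu_next q \<kappa>\<^sub>0 \<kappa> m e * e"
proof -
  define t s p where "t = e powr q" and "s = m powr q" and "p = p_fun q \<kappa>\<^sub>0 \<kappa> e"
  have p: "p = \<kappa>\<^sub>0 * (m1 e powr q * t)"
    by (simp add: p_def p_fun_def t_def mult_ac)
  have pos: "0 < 1 - \<kappa>\<^sub>0 * t" "0 < 1 - p" "0 < 1 - \<kappa>\<^sub>0 * s * t"
    using mu_bounds(1) p_fun_less_one[OF mu_bounds(1,3)]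
      powr_scaled_less_one[OF mu_bounds(1) m] by (auto simp: t_def s_def p_def)
  note u_near = scaled_in_D(1)[OF u m(2)] u scaled_less_one[OF m]
  define c where "c = \<kappa> * (m1 e powr q + s) * t / (1 - \<kappa>\<^sub>0 * s * t) * (1 / (1 - p))"
  define d where "d = 1 / (1 - \<kappa>\<^sub>0 * t) * (\<kappa> * (1 + m1 e powr q) * t / (1 - p))"
  have cd: "0 \<le> c" "0 \<le> d"
    unfolding c_def d_def using pos \<kappa>_pos
    by (auto intro!: mult_nonneg_nonneg divide_nonneg_nonneg simp: t_def s_def)
  define v where "v = T u"
  define Nu Ny Nx where "Nu = blinfun_inv (T' u) v" and "Ny = blinfun_inv (T' y) v"
    and "Nx = blinfun_inv (T' x) v"
  have "u - (2 *\<^sub>R blinfun_inv (T' y) - blinfun_inv (T' x)) v - xs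
      = (u - Nu - xs) + (Nu - Ny) + (Nx - Ny)"
    by (simp add: Nu_def Ny_def Nx_def blinfun.diff_left blinfun.add_left scaleR_2)
  then have "norm (u - (2 *\<^sub>R blinfun_inv (T' y) - blinfun_inv (T' x)) v - xs)
      \<le> norm (u - Nu - xs) + norm (Nu - Ny) + norm (Nx - Ny)"
    by (metis norm_triangle_mono norm_triangle_ineq order_refl)
  also have "norm (u - Nu - xs) \<le> \<kappa> * s * t / ((q + 1) * (1 - \<kappa>\<^sub>0 * s * t)) * (m * e)"
    using newton_le[OF u_near] m
    by (simp add: scaled_powr Nu_def v_def s_def t_def mult.assoc)
  also have "norm (Nu - Ny) \<le> c * norm (A v)"
  proof -
    have "\<kappa> * ((m * e) powr q + (m1 e * e) powr q)
          / ((1 - \<kappa>\<^sub>0 * (m * e) powr q) * (1 - \<kappa>\<^sub>0 * (m1 e * e) powr q)) = c"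
      by (simp only: times_divide_times_eq scaled_powr[OF mu_bounds(2)] scaled_powr[OF m(1)]
          c_def p t_def s_def) (simp add: distrib_left distrib_right mult_ac add.commute)
    then show ?thesis
      using norm_inv_diff_le[OF u_near y_near, of v] by (simp add: Nu_def Ny_def)
  qed
  also have "norm (Nx - Ny) \<le> d * norm (A v)"
    using norm_inv_xy_diff_le[of v] by (simp add: Nx_def Ny_def d_def p_def t_def)
  also have "norm (A v) \<le> (1 + \<kappa>\<^sub>0 / (q + 1) * s * t) * (m * e)"
    using norm_A_T_le[OF u_near(1,2)] m by (simp add: scaled_powr v_def s_def t_def mult.assoc)
  finally have "norm (u - (2 *\<^sub>R blinfun_inv (T' y) - blinfun_inv (T' x)) v - xs)
      \<le> \<kappa> * s * t / ((q + 1) * (1 - \<kappa>\<^sub>0 * s * t)) * (m * e)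
        + c * ((1 + \<kappa>\<^sub>0 / (q + 1) * s * t) * (m * e)) + d * ((1 + \<kappa>\<^sub>0 / (q + 1) * s * t) * (m * e))"
    using cd by (simp add: mult_left_mono add_mono)
  also have "\<dots> = mu_next q \<kappa>\<^sub>0 \<kappa> m e * e"
    unfolding mu_next_def t_def[symmetric] s_def[symmetric] p_def[symmetric]
      c_def[symmetric] d_def[symmetric]
    by (simp only: distrib_right mult.assoc)
  finally show ?thesis
    by (simp add: v_def)
qed

lemma norm_z2_le: "norm (z2_step T T' x - xs) \<le> m3 e * e"
  unfolding z2_step_def mu3_def
  by (intro norm_correction_le norm_z1_le mu_bounds)

lemma norm_x_step_le: "norm (x_step T T' x - xs) \<le> m4 e * e"
  unfolding x_step_def mu4_def
  by (intro norm_correction_le norm_z2_le mu_bounds)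

end

section \<open>Convergence and uniqueness\<close>

lemma x_seq_in_ball:
  assumes "ball xs (rho q \<kappa>\<^sub>0 \<kappa>) \<subseteq> D" "norm (x\<^sub>0 - xs) < rho q \<kappa>\<^sub>0 \<kappa>"
  shows "norm (x_seq T T' x\<^sub>0 n - xs) < rho q \<kappa>\<^sub>0 \<kappa>"
proof (induction n)
  case (Suc n)
  show ?case
    using scaled_in_D(2)[OF assms(1) Suc norm_x_step_le[OF assms(1) Suc]]
      mu_bounds(9)[OF assms(1) Suc] by simp
qed (use assms in simp)

lemma x_seq_tendsto:
  assumes "ball xs (rho q \<kappa>\<^sub>0 \<kappa>) \<subseteq> D" "norm (x\<^sub>0 - xs) < rho q \<kappa>\<^sub>0 \<kappa>"
  shows "x_seq T T' x\<^sub>0 \<longlonglongrightarrow> xs"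
proof -
  define d where "d n = norm (x_seq T T' x\<^sub>0 n - xs)" for n
  obtain c where c: "0 \<le> c" "c < 1" "\<And>a. 0 \<le> a \<Longrightarrow> a \<le> d 0 \<Longrightarrow> m4 a \<le> c"
    using m4_contraction[of "d 0"] assms(2) by (auto simp: d_def)
  \<comment> \<open>The factor \<open>c\<close> is valid only up to the initial error; the geometric
    bound proved next restores this condition at each stage.\<close>
  have step: "d (Suc n) \<le> c * d n" if "d n \<le> d 0" for n
  proof -
    have "d (Suc n) \<le> m4 (d n) * d n"
      unfolding d_def x_seq.simps by (rule norm_x_step_le[OF assms(1) x_seq_in_ball[OF assms]])
    also have "\<dots> \<le> c * d n"
      using that by (intro mult_right_mono c(3)) (auto simp: d_def)
    finally show ?thesis .
  qed
  have bound: "d n \<le> c ^ n * d 0" for n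
  proof (induction n)
    case (Suc n)
    have "c ^ n * d 0 \<le> 1 * d 0"
      using c by (intro mult_right_mono power_le_one) (auto simp: d_def)
    then have "d (Suc n) \<le> c * d n"
      using Suc step by simp
    also have "\<dots> \<le> c * (c ^ n * d 0)"
      using Suc c(1) by (rule mult_left_mono)
    finally show ?case
      by (simp add: mult_ac)
  qed simp
  have "(\<lambda>n. c ^ n * d 0) \<longlonglongrightarrow> 0"
    using c by (intro tendsto_mult_left_zero LIMSEQ_power_zero) auto
  then have "(\<lambda>n. x_seq T T' x\<^sub>0 n - xs) \<longlonglongrightarrow> 0"
    by (rule Lim_null_comparison[rotated]) (use bound in \<open>auto simp: d_def\<close>)
  then show ?thesis
    by (simp add: LIM_zero_iff)
qed

text \<open>At a second zero at distance \<open>d > 0\<close> the linearization bound would read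
  \<open>d \<le> \<kappa>\<^sub>0 / (q + 1) * d powr q * d\<close>. The strict bound on
  \<open>r\<close> makes the factor before the last \<open>d\<close> less than 1, a
  contradiction.\<close>

lemma zero_unique:
  assumes u: "u \<in> D" "T u = 0" and r: "norm (u - xs) \<le> r" "r < ((1 + q) / \<kappa>\<^sub>0) powr (1 / q)"
  shows "u = xs"
proof (rule ccontr)
  define d where "d = norm (u - xs)"
  assume "u \<noteq> xs"
  then have d: "0 < d"
    by (simp add: d_def)
  have "d powr q < (((1 + q) / \<kappa>\<^sub>0) powr (1 / q)) powr q"
    using r q by (intro powr_less_mono2) (auto simp: d_def)
  also have "\<dots> = (1 + q) / \<kappa>\<^sub>0"
    using q \<kappa> by (simp add: powr_powr)
  finally have "\<kappa>\<^sub>0 / (q + 1) * d powr q < 1"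
    using q \<kappa> by (simp add: field_simps)
  then have "\<kappa>\<^sub>0 / (q + 1) * d powr q * d < 1 * d"
    using d by (rule mult_strict_right_mono)
  then show False
    using linearization_le[OF u(1)] u(2) by (simp add: d_def norm_minus_commute)
qed

end

theorem theorem3p1:
  fixes T :: "'a::banach \<Rightarrow> 'b::banach"
    and T' :: "'a \<Rightarrow> 'a \<Rightarrow>\<^sub>L 'b"
    and D :: "'a set"
    and xs x\<^sub>0 :: 'a
    and q \<kappa>\<^sub>0 \<kappa> :: real
  defines "\<rho> \<equiv> rho q \<kappa>\<^sub>0 \<kappa>"
    and "x \<equiv> x_seq T T' x\<^sub>0"
    and "y \<equiv> \<lambda>n. y_step T T' (x_seq T T' x\<^sub>0 n)"
    and "z1 \<equiv> \<lambda>n. z1_step T T' (x_seq T T' x\<^sub>0 n)"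
    and "z2 \<equiv> \<lambda>n. z2_step T T' (x_seq T T' x\<^sub>0 n)"
  assumes "open D" and "convex D"
    and "\<And>u. u \<in> D \<Longrightarrow> (T has_derivative blinfun_apply (T' u)) (at u)"
    and "0 < q" and "q \<le> 1"
    and "0 < \<kappa>\<^sub>0" and "0 < \<kappa>" and "\<kappa>\<^sub>0 \<le> \<kappa>"
    and "xs \<in> D" and "T xs = 0" and "blinfun_invertible (T' xs)"
    and "\<And>u. u \<in> D \<Longrightarrow>
           norm (blinfun_inv (T' xs) o\<^sub>L (T' u - T' xs)) \<le> \<kappa>\<^sub>0 * norm (u - xs) powr q"
    and "\<And>u v. u \<in> D \<Longrightarrow> v \<in> D \<Longrightarrow>
           norm (blinfun_inv (T' xs) o\<^sub>L (T' u - T' v)) \<le> \<kappa> * norm (u - v) powr q"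
    and "ball xs \<rho> \<subseteq> D"
    and "x\<^sub>0 \<in> ball xs \<rho> - {xs}"
  shows "(\<forall>n. blinfun_invertible (T' (x n)) \<and> blinfun_invertible (T' (y n))
              \<and> {x n, y n, z1 n, z2 n} \<subseteq> ball xs \<rho>)
       \<and> x \<longlonglongrightarrow> xs
       \<and> (\<forall>n.
            (norm (y n - xs) \<le> mu1 q \<kappa>\<^sub>0 \<kappa> (norm (x n - xs)) * norm (x n - xs)
             \<and> mu1 q \<kappa>\<^sub>0 \<kappa> (norm (x n - xs)) * norm (x n - xs) \<le> norm (x n - xs)
             \<and> norm (x n - xs) < \<rho>)
          \<and> (norm (z1 n - xs) \<le> mu2 q \<kappa>\<^sub>0 \<kappa> (norm (x n - xs)) * norm (x n - xs)
             \<and> mu2 q \<kappa>\<^sub>0 \<kappa> (norm (x n - xs)) * norm (x n - xs) \<le> norm (x n - xs)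
             \<and> norm (x n - xs) < \<rho>)
          \<and> (norm (z2 n - xs) \<le> mu3 q \<kappa>\<^sub>0 \<kappa> (norm (x n - xs)) * norm (x n - xs)
             \<and> mu3 q \<kappa>\<^sub>0 \<kappa> (norm (x n - xs)) * norm (x n - xs) \<le> norm (x n - xs)
             \<and> norm (x n - xs) < \<rho>)
          \<and> (norm (x (Suc n) - xs) \<le> mu4 q \<kappa>\<^sub>0 \<kappa> (norm (x n - xs)) * norm (x n - xs)
             \<and> mu4 q \<kappa>\<^sub>0 \<kappa> (norm (x n - xs)) * norm (x n - xs) \<le> norm (x n - xs)
             \<and> norm (x n - xs) < \<rho>))
       \<and> (\<forall>r. r \<in> {\<rho> ..< ((1 + q) / \<kappa>\<^sub>0) powr (1 / q)} \<and> cball xs r \<subseteq> D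
             \<longrightarrow> {u \<in> D \<inter> cball xs r. T u = 0} = {xs})"
proof -
  interpret H: holder_operator q \<kappa>\<^sub>0 \<kappa> T T' D xs
    by unfold_locales (use assms in auto)
  have ball: "ball xs (rho q \<kappa>\<^sub>0 \<kappa>) \<subseteq> D" and x0: "norm (x\<^sub>0 - xs) < rho q \<kappa>\<^sub>0 \<kappa>"
    using \<open>ball xs \<rho> \<subseteq> D\<close> \<open>x\<^sub>0 \<in> ball xs \<rho> - {xs}\<close>
    by (auto simp: \<rho>_def dist_norm norm_minus_commute)
  note in_ball = H.x_seq_in_ball[OF ball x0]
  have rho: "0 < rho q \<kappa>\<^sub>0 \<kappa>"
    using x0 norm_ge_zero[of "x\<^sub>0 - xs"] by linarith
  have step: "blinfun_invertible (T' (x n)) \<and> blinfun_invertible (T' (y n))"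
    "norm (y n - xs) \<le> mu1 q \<kappa>\<^sub>0 \<kappa> (norm (x n - xs)) * norm (x n - xs)"
    "norm (z1 n - xs) \<le> mu2 q \<kappa>\<^sub>0 \<kappa> (norm (x n - xs)) * norm (x n - xs)"
    "norm (z2 n - xs) \<le> mu3 q \<kappa>\<^sub>0 \<kappa> (norm (x n - xs)) * norm (x n - xs)"
    "norm (x (Suc n) - xs) \<le> mu4 q \<kappa>\<^sub>0 \<kappa> (norm (x n - xs)) * norm (x n - xs)"
    "norm (x n - xs) < \<rho>" for n
    using in_ball[of n] H.norm_y_le[OF ball in_ball] H.norm_z1_le[OF ball in_ball]
      H.norm_z2_le[OF ball in_ball] H.norm_x_step_le[OF ball in_ball]
      H.invertible[OF H.x_near[OF ball in_ball]] H.invertible[OF H.y_near[OF ball in_ball]]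
    by (simp_all add: x_def y_def z1_def z2_def \<rho>_def)
  have shrink: "mu1 q \<kappa>\<^sub>0 \<kappa> (norm (x n - xs)) * norm (x n - xs) \<le> norm (x n - xs)"
    "mu2 q \<kappa>\<^sub>0 \<kappa> (norm (x n - xs)) * norm (x n - xs) \<le> norm (x n - xs)"
    "mu3 q \<kappa>\<^sub>0 \<kappa> (norm (x n - xs)) * norm (x n - xs) \<le> norm (x n - xs)"
    "mu4 q \<kappa>\<^sub>0 \<kappa> (norm (x n - xs)) * norm (x n - xs) \<le> norm (x n - xs)" for n
    using H.below_rho[of "norm (x n - xs)"] step(6)[of n]
    by (auto simp: \<rho>_def intro!: mult_left_le_one_le)
  have in_balls: "{x n, y n, z1 n, z2 n} \<subseteq> ball xs \<rho>" for n
    using step(2-4,6)[of n] shrink[of n] by (simp add: dist_norm norm_minus_commute)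
  have "x \<longlonglongrightarrow> xs"
    unfolding x_def by (rule H.x_seq_tendsto[OF ball x0])
  \<comment> \<open>Positivity of the radius puts \<open>xs\<close> itself in the closed ball, so
    the solution set is not empty.\<close>
  moreover have "{u \<in> D \<inter> cball xs r. T u = 0} = {xs}"
    if "r \<in> {\<rho> ..< ((1 + q) / \<kappa>\<^sub>0) powr (1 / q)}" for r
    using that rho H.zero_unique[of _ r] H.xs H.T_xs
    by (auto simp: \<rho>_def dist_norm norm_minus_commute)
  ultimately show ?thesis
    using step shrink in_balls by blast
qed

end
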